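(* Let $n,k,l$ be positive integers with $\gcd(k,l)=1$, $n\nmid k$ and $n\nmid l$, and let $L=L(I(n,k,l))$ be the Laplacian matrix of the $I$-graph $I(n,k,l)$, viewed as a homomorphism $\mathbb{Z}^{2n}\to\mathbb{Z}^{2n}$. Let $\mathcal{A}$ be the $2(k+l)\times 2(k+l)$ companion matrix of the Laurent polynomial $(3-z^{k}-z^{-k})(3-z^{l}-z^{-l})-1$, and let $I$ be the identity matrix of order $2(k+l)$. Then $$\operatorname{coker} L\cong \operatorname{coker}(\mathcal{A}^{n}-I)$$ as abelian groups.
   Context: The $I$-graph $I(n,k,l)$ is the multigraph with vertex set $\{u_i,v_i : i\in\mathbb{Z}/n\}$ and with edges $u_iu_{i+l}$, $u_iv_i$, $v_iv_{i+k}$, one of each kind for every $i\in\mathbb{Z}/n$ (subscripts modulo $n$; $3n$ edges in total). Thus multiple edges are allowed (e.g. if $l=n/2$), and the graph is $3$-valent; the conditions $n\nmid k$, $n\nmid l$ say there are no loops. The Laplacian of a loopless multigraph $G$ is $L(G)=D(G)-A(G)$, where $A(G)=(a_{uv})$ with $a_{uv}$ the number of edges between $u$ and $v$, and $D(G)$ is the diagonal matrix of vertex degrees. For an integer $m\times m$ matrix $M$, $\operatorname{coker}M=\mathbb{Z}^m/\operatorname{im}M$, where $M$ is viewed as a homomorphism $\mathbb{Z}^m\to\mathbb{Z}^m$. For a bimonic integer Laurent polynomial $P(z)=z^p+a_1z^{p+1}+\cdots+a_{s-1}z^{p+s-1}+z^{p+s}$ (with $p,a_1,\dots,a_{s-1}\in\mathbb{Z}$,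 $s\ge 1$), its companion matrix is the $s\times s$ matrix whose first $s-1$ rows are $(0\mid I_{s-1})$ (a zero column followed by the identity matrix of order $s-1$) and whose last row is $(-1,-a_1,\dots,-a_{s-1})$. The Laurent polynomial $(3-z^{k}-z^{-k})(3-z^{l}-z^{-l})-1$ is bimonic with $p=-(k+l)$, $s=2(k+l)$. *)

theory Defs
  imports
    Jordan_Normal_Form.Matrix
    "HOL-Library.Poly_Mapping"
    "HOL-Library.Uprod"
    "HOL-Library.Multiset"
    "HOL-Algebra.Coset"
begin

section \<open>Multigraphs and their Laplacians\<close>

record 'a multigraph =
  verts :: "'a set"
  edges :: "'a uprod multiset"

text \<open>
  The degree counts every edge at \<open>v\<close> once, which is the usual degree for loopless multigraphs;
  the Laplacian is only used for those.
\<close>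

definition multigraph_degree :: "'a multigraph \<Rightarrow> 'a \<Rightarrow> nat" where
  "multigraph_degree G v = size {# e \<in># edges G. v \<in> set_uprod e #}"

definition loopless :: "'a multigraph \<Rightarrow> bool" where
  "loopless G \<longleftrightarrow> (\<forall>e \<in># edges G. proper_uprod e)"

text \<open>
  Matrices are indexed by positions in an enumeration \<open>vs\<close> of the vertices.
\<close>

definition vertex_enumeration :: "'a list \<Rightarrow> 'a multigraph \<Rightarrow> bool" where
  "vertex_enumeration vs G \<longleftrightarrow> distinct vs \<and> set vs = verts G"

definition adjacency_matrix :: "'a list \<Rightarrow> 'a multigraph \<Rightarrow> int mat" where
  "adjacency_matrix vs G =
     mat (length vs) (length vs) (\<lambda>(i, j). int (count (edges G) (Upair (vs ! i) (vs ! j))))"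

definition degree_matrix :: "'a list \<Rightarrow> 'a multigraph \<Rightarrow> int mat" where
  "degree_matrix vs G =
     mat (length vs) (length vs)
       (\<lambda>(i, j). if i = j then int (multigraph_degree G (vs ! i)) else 0)"

definition laplacian_matrix :: "'a list \<Rightarrow> 'a multigraph \<Rightarrow> int mat" where
  "laplacian_matrix vs G = degree_matrix vs G - adjacency_matrix vs G"

section \<open>The graph \<open>I(n,k,l)\<close>\<close>

text \<open>The residue classes modulo \<open>n\<close> are represented by \<open>0, \<dots>, n - 1\<close>.\<close>

datatype I_vertex = U nat | V nat

definition I_graph :: "nat \<Rightarrow> nat \<Rightarrow> nat \<Rightarrow> I_vertex multigraph" where
  "I_graph n k l =
     \<lparr> verts = U ` {..<n} \<union> V ` {..<n},
       edges =
           {# Upair (U i) (U ((i + l) mod n)). i \<in># mset_set {..<n} #}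
         + {# Upair (U i) (V i). i \<in># mset_set {..<n} #}
         + {# Upair (V i) (V ((i + k) mod n)). i \<in># mset_set {..<n} #} \<rparr>"

lemma size_edges_I_graph: "size (edges (I_graph n k l)) = 3 * n"
  by (simp add: I_graph_def)

lemma loopless_I_graph:
  assumes "\<not> n dvd k" "\<not> n dvd l"
  shows "loopless (I_graph n k l)"
proof -
  have shift: "i \<noteq> (i + m) mod n" if "\<not> n dvd m" "i < n" for i m
  proof
    assume "i = (i + m) mod n"
    hence "(i + 0) mod n = (i + m) mod n" using that by simp
    hence "n dvd m"
      by (metis add_diff_cancel_left' add.right_neutral le_add1 mod_eq_dvd_iff_nat)
    with that show False by simp
  qed
  show ?thesis
    using shift[OF assms(1)] shift[OF assms(2)]
    by (auto simp: loopless_def I_graph_def)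
qed

section \<open>Cokernels\<close>

definition coker :: "int mat \<Rightarrow> int vec set monoid" where
  "coker M =
     monoid_vec TYPE(int) (dim_row M) Mod ((\<lambda>x. M *\<^sub>v x) ` carrier_vec (dim_col M))"

lemma comm_group_coker: "comm_group (coker M)"
proof -
  interpret Z: comm_group "monoid_vec TYPE(int) (dim_row M)"
    by (rule comm_group_vec)
  interpret D: comm_group "monoid_vec TYPE(int) (dim_col M)"
    by (rule comm_group_vec)
  have "(\<lambda>x. M *\<^sub>v x)
      \<in> hom (monoid_vec TYPE(int) (dim_col M)) (monoid_vec TYPE(int) (dim_row M))"
    using mult_add_distrib_mat_vec[of M "dim_row M" "dim_col M"]
      mult_mat_vec_carrier[of M "dim_row M" "dim_col M"]
    unfolding hom_def monoid_vec_simps by blast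
  then interpret group_hom "monoid_vec TYPE(int) (dim_col M)"
      "monoid_vec TYPE(int) (dim_row M)" "\<lambda>x. M *\<^sub>v x"
    by (intro group_hom.intro group_hom_axioms.intro Z.is_group D.is_group)
  show ?thesis
    using Z.abelian_FactGroup[OF img_is_subgroup] unfolding coker_def monoid_vec_simps .
qed

section \<open>Companion matrices of Laurent polynomials\<close>

text \<open>
  The type \<open>int \<Rightarrow>\<^sub>0 int\<close> of finitely supported functions with convolution as multiplication is
  the ring of integer Laurent polynomials; the coefficient of \<open>z ^ i\<close> is the value at \<open>i\<close>.
\<close>

type_synonym laurent = "int \<Rightarrow>\<^sub>0 int"

definition zpow :: "int \<Rightarrow> laurent" where
  "zpow i = Poly_Mapping.single i 1"

definition low_exponent :: "laurent \<Rightarrow> int" where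
  "low_exponent P = Min (Poly_Mapping.keys P)"

definition span_width :: "laurent \<Rightarrow> nat" where
  "span_width P = nat (Max (Poly_Mapping.keys P) - Min (Poly_Mapping.keys P))"

definition bimonic :: "laurent \<Rightarrow> bool" where
  "bimonic P \<longleftrightarrow> 1 \<le> span_width P
     \<and> Poly_Mapping.lookup P (low_exponent P) = 1
     \<and> Poly_Mapping.lookup P (low_exponent P + int (span_width P)) = 1"

text \<open>
  Meant for bimonic \<open>P\<close>; the constant \<open>-1\<close> in the lower left corner is minus the coefficient of
  the lowest power.
\<close>

definition companion_matrix :: "laurent \<Rightarrow> int mat" where
  "companion_matrix P =
     (let s = span_width P; a = (\<lambda>j. Poly_Mapping.lookup P (low_exponent P + int j))
      in mat s s (\<lambda>(i, j).
           if i < s - 1 then (if j = i + 1 then 1 else 0)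
           else (if j = 0 then - 1 else - a j)))"

definition I_laurent :: "nat \<Rightarrow> nat \<Rightarrow> laurent" where
  "I_laurent k l =
     (3 - zpow (int k) - zpow (- int k)) * (3 - zpow (int l) - zpow (- int l)) - 1"

lemma I_laurent_exponents:
  assumes "k > 0" "l > 0"
  shows "low_exponent (I_laurent k l) = - int (k + l)"
    and "span_width (I_laurent k l) = 2 * (k + l)"
    and "bimonic (I_laurent k l)"
proof -
  let ?P = "I_laurent k l"
  have numeral_times: "3 * zpow i = Poly_Mapping.single i 3" for i
  proof -
    have "3 * zpow i = zpow i + zpow i + zpow i" by simp
    thus ?thesis by (simp add: zpow_def flip: single_add)
  qed
  have "?P = 8 - 3 * zpow (int k) - 3 * zpow (- int k) - 3 * zpow (int l) - 3 * zpow (- int l)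
      + zpow (int k) * zpow (int l) + zpow (int k) * zpow (- int l)
      + zpow (- int k) * zpow (int l) + zpow (- int k) * zpow (- int l)"
    by (simp add: I_laurent_def algebra_simps)
  also have "\<dots> = 8
      - Poly_Mapping.single (int k) 3 - Poly_Mapping.single (- int k) 3
      - Poly_Mapping.single (int l) 3 - Poly_Mapping.single (- int l) 3
      + Poly_Mapping.single (int k + int l) 1 + Poly_Mapping.single (int k - int l) 1
      + Poly_Mapping.single (- int k + int l) 1 + Poly_Mapping.single (- int k - int l) 1"
    unfolding numeral_times by (simp add: zpow_def mult_single)
  finally have expand: "Poly_Mapping.lookup ?P i =
      (8 when i = 0) - (3 when int k = i) - (3 when - int k = i)
      - (3 when int l = i) - (3 when - int l = i)
      + (1 when int k + int l = i) + (1 when int k - int l = i)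
      + (1 when - int k + int l = i) + (1 when - int k - int l = i)" for i
    by (simp only: lookup_add lookup_minus lookup_single lookup_numeral)
  have lo: "Poly_Mapping.lookup ?P (- int (k + l)) = 1"
    and hi: "Poly_Mapping.lookup ?P (int (k + l)) = 1"
    using assms by (simp_all add: expand when_def)
  have out: "Poly_Mapping.lookup ?P i = 0" if "i < - int (k + l) \<or> int (k + l) < i" for i
  proof -
    have "i \<noteq> 0" "int k \<noteq> i" "- int k \<noteq> i" "int l \<noteq> i" "- int l \<noteq> i" "int k + int l \<noteq> i"
      "int k - int l \<noteq> i" "- int k + int l \<noteq> i" "- int k - int l \<noteq> i"
      using assms that by linarith+
    thus ?thesis by (simp only: expand when_simps) simp
  qed
  have keys: "- int (k + l) \<in> Poly_Mapping.keys ?P" "int (k + l) \<in> Poly_Mapping.keys ?P"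
    using lo hi by (simp_all add: in_keys_iff del: of_nat_add)
  have bounds: "- int (k + l) \<le> i \<and> i \<le> int (k + l)" if "i \<in> Poly_Mapping.keys ?P" for i
    using out[of i] that unfolding in_keys_iff by linarith
  have min: "Min (Poly_Mapping.keys ?P) = - int (k + l)"
    using keys bounds by (intro Min_eqI) simp_all
  have max: "Max (Poly_Mapping.keys ?P) = int (k + l)"
    using keys bounds by (intro Max_eqI) simp_all
  show low: "low_exponent ?P = - int (k + l)"
    using min by (simp add: low_exponent_def)
  show width: "span_width ?P = 2 * (k + l)"
    using min max by (simp add: span_width_def)
  show "bimonic ?P"
    using lo hi assms unfolding bimonic_def low width by simp
qed

end

theory Submission
  imports
    Defs
    "HOL-Computational_Algebra.Polynomial"
    "HOL-Number_Theory.Cong"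
begin

text \<open>
  Both groups are \<open>\<int>[X]/(X\<^sup>n - 1, p)\<close>, where \<open>p\<close> is the polynomial
  \<open>X\<^sup>k\<^sup>+\<^sup>l ((3 - X\<^sup>k - X\<^sup>-\<^sup>k) (3 - X\<^sup>l - X\<^sup>-\<^sup>l) - 1)\<close>.

  For the graph, read a generator \<open>u\<^sub>i\<close> as \<open>X\<^sup>i\<close>, so that functions on the \<open>u\<^sub>i\<close> form the ring
  \<open>\<int>[X]/(X\<^sup>n - 1)\<close> and rotation of the indices is multiplication by \<open>X\<close>. The relation given by the
  vertex \<open>u\<^sub>i\<close> expresses \<open>v\<^sub>i\<close> as \<open>(3 - X\<^sup>l - X\<^sup>-\<^sup>l) X\<^sup>i\<close>. Once the \<open>v\<^sub>i\<close> are eliminated, the relation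
  given by the vertex \<open>v\<^sub>i\<close> is \<open>X\<^sup>i\<close> times the Laurent polynomial in question, and \<open>X\<close> is a unit.
  This is \<open>coker_laplacian_I_graph\<close>.

  For the companion matrix, \<open>\<int>[X]/(p)\<close> is free of rank \<open>degree p\<close> because \<open>p\<close> is monic, and in the
  basis of Horner's polynomials multiplication by \<open>X\<close> is the companion matrix \<open>A\<close>. Dividing further
  by \<open>X\<^sup>n - 1\<close> therefore gives \<open>coker (A\<^sup>n - I)\<close>. The inverse isomorphism is \<open>f \<mapsto> f(A) e\<close>, with \<open>e\<close>
  the last unit vector; its coordinates are values of the linear recurring sequence with
  characteristic polynomial \<open>p\<close> and initial values \<open>0, \<dots>, 0, 1\<close>. This is \<open>coker_companion_power\<close>.
\<close>

section \<open>Cokernels as quotients of an additive group\<close>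

definition quotient_group :: "'r::ab_group_add set \<Rightarrow> 'r set monoid" where
  "quotient_group J = \<lparr>carrier = UNIV, mult = (+), one = 0\<rparr> Mod J"

text \<open>
  Both cokernels of the main result are compared with one quotient of a polynomial ring through
  this criterion. The maps \<open>b\<close> and \<open>d\<close> are inverse to each other only up to \<open>im M\<close> and \<open>J\<close>, which
  is what explicit formulas on representatives provide. It follows that \<open>b\<close> followed by reduction
  modulo \<open>J\<close> is a surjective homomorphism with kernel \<open>im M\<close>, and the first isomorphism theorem
  applies.
\<close>

lemma coker_iso_quotient_group:
  fixes M :: "int mat" and b :: "int vec \<Rightarrow> 'r::ab_group_add" and d :: "'r \<Rightarrow> int vec"
  assumes M: "M \<in> carrier_mat m m"
    and J: "0 \<in> J" "\<And>f g. f \<in> J \<Longrightarrow> g \<in> J \<Longrightarrow> f + g \<in> J" "\<And>f. f \<in> J \<Longrightarrow> - f \<in> J"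
    and b_add: "\<And>x y. x \<in> carrier_vec m \<Longrightarrow> y \<in> carrier_vec m \<Longrightarrow> b (x + y) = b x + b y"
    and b_im: "\<And>y. y \<in> carrier_vec m \<Longrightarrow> b (M *\<^sub>v y) \<in> J"
    and d_carrier: "\<And>f. d f \<in> carrier_vec m"
    and d_J: "\<And>f. f \<in> J \<Longrightarrow> \<exists>y \<in> carrier_vec m. d f = M *\<^sub>v y"
    and bd: "\<And>f. b (d f) - f \<in> J"
    and db: "\<And>x. x \<in> carrier_vec m \<Longrightarrow> \<exists>y \<in> carrier_vec m. x = d (b x) + M *\<^sub>v y"
  shows "coker M \<cong> quotient_group J"
proof -
  define Z where "Z = monoid_vec TYPE(int) m"
  define R where "R = (\<lparr>carrier = UNIV, mult = (+), one = 0\<rparr> :: 'r monoid)"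
  have R_simps: "carrier R = UNIV" "x \<otimes>\<^bsub>R\<^esub> y = x + y" "\<one>\<^bsub>R\<^esub> = 0" for x y
    by (simp_all add: R_def)
  interpret Z: comm_group Z unfolding Z_def by (rule comm_group_vec)
  interpret R: comm_group R
  proof (rule comm_groupI)
    show "\<exists>y\<in>carrier R. y \<otimes>\<^bsub>R\<^esub> x = \<one>\<^bsub>R\<^esub>" for x
      by (rule bexI[of _ "- x"]) (simp_all add: R_simps)
  qed (simp_all add: R_simps algebra_simps)
  have inv_R: "inv\<^bsub>R\<^esub> x = - x" for x
    by (rule R.inv_equality) (simp_all add: R_simps)
  have "subgroup J R"
    by (rule R.subgroupI) (use J in \<open>auto simp: R_simps inv_R\<close>)
  then interpret J: normal J R
    using R.subgroup_imp_normal by blast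
  define h where "h = (\<lambda>a. J #>\<^bsub>R\<^esub> a) \<circ> b"
  have "b \<in> hom Z R"
    using b_add by (auto simp: hom_def Z_def monoid_vec_simps R_simps)
  hence "h \<in> hom Z (R Mod J)"
    unfolding h_def using hom_compose J.r_coset_hom_Mod by blast
  then interpret h: group_hom Z "R Mod J" h
    by (intro group_hom.intro group_hom_axioms.intro Z.is_group J.factorgroup_is_group)
  have coset_eq: "J #>\<^bsub>R\<^esub> a = J #>\<^bsub>R\<^esub> c \<longleftrightarrow> a - c \<in> J" for a c
  proof
    assume "J #>\<^bsub>R\<^esub> a = J #>\<^bsub>R\<^esub> c"
    hence "a \<in> J #>\<^bsub>R\<^esub> c"
      using R.rcos_self[OF _ \<open>subgroup J R\<close>, of a] by (simp add: R_simps)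
    thus "a - c \<in> J" by (auto simp: r_coset_def R_simps)
  next
    assume "a - c \<in> J"
    hence "a \<in> J #>\<^bsub>R\<^esub> c"
      by (auto simp: r_coset_def R_simps intro!: bexI[of _ "a - c"])
    thus "J #>\<^bsub>R\<^esub> a = J #>\<^bsub>R\<^esub> c"
      using R.repr_independence[OF _ _ \<open>subgroup J R\<close>] by (simp add: R_simps)
  qed
  have one: "\<one>\<^bsub>R Mod J\<^esub> = J #>\<^bsub>R\<^esub> 0"
    by (auto simp: r_coset_def R_simps)
  have "kernel Z (R Mod J) h = {x \<in> carrier_vec m. b x \<in> J}"
    unfolding kernel_def one by (auto simp: h_def coset_eq Z_def monoid_vec_simps)
  also have "\<dots> = (\<lambda>x. M *\<^sub>v x) ` carrier_vec m"
  proof (intro equalityI subsetI)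
    fix x assume "x \<in> {x \<in> carrier_vec m. b x \<in> J}"
    hence x: "x \<in> carrier_vec m" and "b x \<in> J" by auto
    with d_J obtain y where y: "y \<in> carrier_vec m" "d (b x) = M *\<^sub>v y" by blast
    obtain y' where y': "y' \<in> carrier_vec m" "x = d (b x) + M *\<^sub>v y'" using db[OF x] by blast
    have "x = M *\<^sub>v (y + y')"
      using y y' M by (simp add: mult_add_distrib_mat_vec[of M m m])
    moreover have "y + y' \<in> carrier_vec m" using y y' by simp
    ultimately show "x \<in> (\<lambda>x. M *\<^sub>v x) ` carrier_vec m" by (rule image_eqI)
  next
    fix x assume "x \<in> (\<lambda>x. M *\<^sub>v x) ` carrier_vec m"
    then obtain y where "y \<in> carrier_vec m" "x = M *\<^sub>v y" by blast
    thus "x \<in> {x \<in> carrier_vec m. b x \<in> J}" using b_im M by simp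
  qed
  finally have ker: "kernel Z (R Mod J) h = (\<lambda>x. M *\<^sub>v x) ` carrier_vec m" .
  have "X \<in> h ` carrier Z" if X: "X \<in> carrier (R Mod J)" for X
  proof -
    obtain f where f: "X = J #>\<^bsub>R\<^esub> f"
      using X by (auto simp: carrier_FactGroup)
    have "h (d f) = X" by (simp add: f h_def coset_eq bd)
    thus ?thesis using d_carrier by (auto simp: Z_def monoid_vec_simps)
  qed
  hence "h ` carrier Z = carrier (R Mod J)"
    using h.hom_closed by blast
  from h.FactGroup_iso[OF this] show ?thesis
    using M unfolding ker by (simp add: coker_def quotient_group_def Z_def R_def)
qed

section \<open>The ideal generated by \<open>X\<^sup>n - 1\<close> and \<open>p\<close>\<close>

definition relation_ideal :: "nat \<Rightarrow> int poly \<Rightarrow> int poly set" where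
  "relation_ideal n p = {f * (monom 1 n - 1) + g * p | f g. True}"

definition quot_cong :: "nat \<Rightarrow> int poly \<Rightarrow> int poly \<Rightarrow> int poly \<Rightarrow> bool" where
  "quot_cong n p f g \<longleftrightarrow> f - g \<in> relation_ideal n p"

lemma relation_ideal_0: "0 \<in> relation_ideal n p"
  unfolding relation_ideal_def by (intro CollectI exI[of _ 0]) simp

lemma relation_ideal_add:
  assumes "f \<in> relation_ideal n p" "g \<in> relation_ideal n p"
  shows "f + g \<in> relation_ideal n p"
proof -
  obtain f1 f2 g1 g2 where "f = f1 * (monom 1 n - 1) + f2 * p" "g = g1 * (monom 1 n - 1) + g2 * p"
    using assms unfolding relation_ideal_def by blast
  hence "f + g = (f1 + g1) * (monom 1 n - 1) + (f2 + g2) * p" by (simp add: algebra_simps)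
  thus ?thesis unfolding relation_ideal_def by blast
qed

lemma relation_ideal_mult:
  assumes "f \<in> relation_ideal n p"
  shows "g * f \<in> relation_ideal n p"
proof -
  obtain f1 f2 where "f = f1 * (monom 1 n - 1) + f2 * p"
    using assms unfolding relation_ideal_def by blast
  hence "g * f = (g * f1) * (monom 1 n - 1) + (g * f2) * p"
    by (simp only: distrib_left mult.assoc)
  thus ?thesis unfolding relation_ideal_def by blast
qed

lemma relation_ideal_uminus: "f \<in> relation_ideal n p \<Longrightarrow> - f \<in> relation_ideal n p"
  using relation_ideal_mult[of f n p "- 1"] by simp

lemma quot_cong_refl [simp, intro]: "quot_cong n p f f"
  by (simp add: quot_cong_def relation_ideal_0)

lemma quot_cong_sym: "quot_cong n p f g \<Longrightarrow> quot_cong n p g f"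
  unfolding quot_cong_def using relation_ideal_uminus by fastforce

lemma quot_cong_trans [trans]:
  "quot_cong n p f g \<Longrightarrow> quot_cong n p g h \<Longrightarrow> quot_cong n p f h"
  unfolding quot_cong_def using relation_ideal_add[of "f - g" n p "g - h"] by simp

lemma quot_cong_add:
  "quot_cong n p f g \<Longrightarrow> quot_cong n p f' g' \<Longrightarrow> quot_cong n p (f + f') (g + g')"
  unfolding quot_cong_def using relation_ideal_add[of "f - g" n p "f' - g'"]
  by (simp add: algebra_simps)

lemma quot_cong_minus: "quot_cong n p f g \<Longrightarrow> quot_cong n p (- f) (- g)"
  unfolding quot_cong_def using relation_ideal_uminus[of "f - g" n p] by simp

lemma quot_cong_diff:
  "quot_cong n p f g \<Longrightarrow> quot_cong n p f' g' \<Longrightarrow> quot_cong n p (f - f') (g - g')"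
  using quot_cong_add[OF _ quot_cong_minus, of n p f g f' g'] by simp

lemma quot_cong_mult:
  assumes "quot_cong n p f g" "quot_cong n p f' g'"
  shows "quot_cong n p (f * f') (g * g')"
proof -
  have "f * f' - g * g' = f' * (f - g) + g * (f' - g')" by (simp add: algebra_simps)
  thus ?thesis using assms unfolding quot_cong_def
    by (metis relation_ideal_add relation_ideal_mult)
qed

lemma quot_cong_sum:
  "(\<And>x. x \<in> A \<Longrightarrow> quot_cong n p (f x) (g x)) \<Longrightarrow> quot_cong n p (sum f A) (sum g A)"
  by (induction A rule: infinite_finite_induct) (auto intro: quot_cong_add)

lemma quot_cong_generators:
  "quot_cong n p (monom 1 n) 1" "quot_cong n p p 0"
proof -
  have "monom 1 n - 1 = 1 * (monom 1 n - 1) + 0 * p" "p = 0 * (monom 1 n - 1) + 1 * p" by simp_all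
  thus "quot_cong n p (monom 1 n) 1" "quot_cong n p p 0"
    unfolding quot_cong_def relation_ideal_def diff_0_right by blast+
qed

section \<open>Pairing polynomials with sequences\<close>

text \<open>
  The linear form on \<open>\<int>[X]\<close> sending \<open>X\<^sup>j\<close> to \<open>w j\<close>. Multiplication by \<open>X\<close> turns into a shift of the
  sequence, so ideals of \<open>\<int>[X]\<close> are killed by the sequences that satisfy the corresponding
  linear recurrences: order \<open>degree p\<close> for \<open>(p)\<close>, periodicity for \<open>(X\<^sup>n - 1)\<close>.
\<close>

definition pairing :: "(nat \<Rightarrow> int) \<Rightarrow> int poly \<Rightarrow> int" where
  "pairing w f = (\<Sum>j\<le>degree f. coeff f j * w j)"

lemma pairing_eq_sum:
  assumes "degree f \<le> d"
  shows "pairing w f = (\<Sum>j\<le>d. coeff f j * w j)"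
  unfolding pairing_def using assms
  by (intro sum.mono_neutral_left) (auto simp: coeff_eq_0)

lemma pairing_0 [simp]: "pairing w 0 = 0"
  by (simp add: pairing_def)

lemma pairing_add: "pairing w (f + g) = pairing w f + pairing w g"
proof -
  define d where "d = max (degree f) (degree g)"
  have "degree f \<le> d" "degree g \<le> d" "degree (f + g) \<le> d"
    by (auto simp: d_def degree_add_le)
  thus ?thesis by (simp add: pairing_eq_sum[of _ d] sum.distrib algebra_simps)
qed

lemma pairing_smult: "pairing w (smult c f) = c * pairing w f"
  by (simp add: pairing_eq_sum[of _ "degree f"] sum_distrib_left mult.assoc degree_smult_le)

lemma pairing_diff: "pairing w (f - g) = pairing w f - pairing w g"
  using pairing_add[of w "f - g" g] by simp

lemma pairing_pCons: "pairing w (pCons c f) = c * w 0 + pairing (\<lambda>j. w (Suc j)) f"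
proof -
  have "pairing w (pCons c f) = (\<Sum>j\<le>Suc (degree f). coeff (pCons c f) j * w j)"
    by (rule pairing_eq_sum) (rule degree_pCons_le)
  thus ?thesis by (simp add: sum.atMost_Suc_shift pairing_def del: sum.atMost_Suc)
qed

lemma pairing_monom_mult: "pairing w (monom 1 m * f) = pairing (\<lambda>j. w (j + m)) f"
  by (induction m arbitrary: w) (simp_all add: monom_Suc pairing_pCons monom_0)

lemma pairing_sum: "pairing w (\<Sum>j\<in>A. g j) = (\<Sum>j\<in>A. pairing w (g j))"
  by (induction A rule: infinite_finite_induct) (simp_all add: pairing_add)

lemma pairing_monom: "pairing w (monom c j) = c * w j"
  using pairing_monom_mult[of w j "[:c:]"] by (simp add: pairing_pCons smult_monom mult.commute)

text \<open>
  A sequence obeying the linear recurrence with characteristic polynomial \<open>p\<close> annihilates the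
  ideal \<open>(p)\<close>, because pairing with \<open>X\<^sup>m p\<close> is the recurrence at position \<open>m\<close>.
\<close>

lemma pairing_mult_eq_0:
  assumes "\<And>m. pairing (\<lambda>j. w (j + m)) p = 0"
  shows "pairing w (g * p) = 0"
  using assms
proof (induction g arbitrary: w)
  case (pCons c g)
  have "pairing (\<lambda>j. w (Suc j)) (g * p) = 0"
    using pCons.prems[of "Suc _"] by (intro pCons.IH) simp
  moreover have "pairing w p = 0" using pCons.prems[of 0] by simp
  ultimately show ?case by (simp add: pairing_add pairing_smult pairing_pCons)
qed simp

section \<open>Companion matrices\<close>

text \<open>
  For nonzero \<open>P\<close>, the associate of \<open>P\<close> in the ring of Laurent polynomials that is a polynomial with nonzero
  constant term. Since \<open>X\<close> is invertible modulo \<open>X\<^sup>n - 1\<close>, passing from Laurent polynomials to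
  ordinary ones does not change the quotient by \<open>(X\<^sup>n - 1, P)\<close>.
\<close>

definition shifted_poly :: "laurent \<Rightarrow> int poly" where
  "shifted_poly P =
     (\<Sum>j\<le>span_width P. monom (Poly_Mapping.lookup P (low_exponent P + int j)) j)"

lemma coeff_shifted_poly:
  "coeff (shifted_poly P) j =
     (if j \<le> span_width P then Poly_Mapping.lookup P (low_exponent P + int j) else 0)"
  by (simp add: shifted_poly_def coeff_sum sum.delta)

lemma shifted_poly_bimonic:
  assumes "bimonic P"
  shows "degree (shifted_poly P) = span_width P" "lead_coeff (shifted_poly P) = 1"
    and "coeff (shifted_poly P) 0 = 1"
proof -
  have "coeff (shifted_poly P) (span_width P) = 1"
    using assms by (simp add: coeff_shifted_poly bimonic_def)
  moreover have "degree (shifted_poly P) \<le> span_width P"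
    by (rule degree_le) (simp add: coeff_shifted_poly)
  ultimately show "degree (shifted_poly P) = span_width P"
    using le_degree[of "shifted_poly P" "span_width P"] by simp
  then show "lead_coeff (shifted_poly P) = 1"
    using \<open>coeff (shifted_poly P) (span_width P) = 1\<close> by simp
  show "coeff (shifted_poly P) 0 = 1"
    using assms by (simp add: coeff_shifted_poly bimonic_def)
qed

definition companion :: "int poly \<Rightarrow> int mat" where
  "companion p = mat (degree p) (degree p) (\<lambda>(i, j).
     if i < degree p - 1 then (if j = i + 1 then 1 else 0) else - coeff p j)"

lemma companion_matrix_eq_companion:
  assumes "bimonic P"
  shows "companion_matrix P = companion (shifted_poly P)"
proof -
  have "coeff (shifted_poly P) 0 = 1" by (rule shifted_poly_bimonic[OF assms])
  thus ?thesis
    unfolding companion_matrix_def companion_def shifted_poly_bimonic(1)[OF assms] Let_def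
    by (intro eq_matI) (auto simp: coeff_shifted_poly)
qed

lemma companion_carrier [simp]: "companion p \<in> carrier_mat (degree p) (degree p)"
  by (simp add: companion_def)

lemma companion_mult_vec:
  assumes "x \<in> carrier_vec (degree p)" "i < degree p"
  shows "(companion p *\<^sub>v x) $ i =
    (if i < degree p - 1 then x $ Suc i else - (\<Sum>j<degree p. coeff p j * x $ j))"
proof -
  have "(companion p *\<^sub>v x) $ i = (\<Sum>j<degree p. companion p $$ (i, j) * x $ j)"
    using assms by (simp add: companion_def scalar_prod_def atLeast0LessThan)
  also have "\<dots> = (\<Sum>j<degree p. (if i < degree p - 1 then (if j = Suc i then x $ j else 0)
                   else - (coeff p j * x $ j)))"
    using assms by (intro sum.cong) (auto simp: companion_def)
  also have "\<dots> = (if i < degree p - 1 then x $ Suc i else - (\<Sum>j<degree p. coeff p j * x $ j))"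
    using assms by (auto simp: sum.delta sum_negf)
  finally show ?thesis .
qed

text \<open>
  The solution of the linear recurrence with characteristic polynomial \<open>p\<close> (supposed monic) whose
  initial values \<open>0, \<dots>, 0, 1\<close> are the coordinates of the last unit vector.
\<close>

function impulse_response :: "int poly \<Rightarrow> nat \<Rightarrow> int" where
  "impulse_response p i =
     (if i < degree p - 1 then 0 else if i = degree p - 1 then 1
      else - (\<Sum>j<degree p. coeff p j * impulse_response p (i - degree p + j)))"
  by auto
termination by (relation "Wellfounded.measure snd") auto

declare impulse_response.simps [simp del]

lemma impulse_response_initial:
  "i < degree p - 1 \<Longrightarrow> impulse_response p i = 0"
  "impulse_response p (degree p - 1) = 1"
  by (simp_all add: impulse_response.simps)

lemma pairing_impulse_response:
  assumes "lead_coeff p = 1" "degree p > 0"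
  shows "pairing (\<lambda>j. impulse_response p (j + m)) (g * p) = 0"
proof (rule pairing_mult_eq_0)
  fix m'
  define i where "i = degree p + (m + m')"
  have "impulse_response p i =
      - (\<Sum>j<degree p. coeff p j * impulse_response p (i - degree p + j))"
    by (subst impulse_response.simps) (use assms in \<open>simp add: i_def\<close>)
  hence "(\<Sum>j<degree p. coeff p j * impulse_response p (j + m' + m))
      + impulse_response p (degree p + m' + m) = 0"
    by (simp add: i_def add_ac)
  thus "pairing (\<lambda>j. impulse_response p (j + m' + m)) p = 0"
    using assms by (simp add: pairing_def lessThan_Suc_atMost [symmetric])
qed

text \<open>
  For monic \<open>p\<close> this is \<open>f(A) e\<close>, where \<open>A\<close> is the companion matrix and \<open>e\<close> the last unit vector:
  the vector \<open>A\<^sup>j e\<close> consists of the \<open>degree p\<close> consecutive values of the impulse response from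
  position \<open>j\<close> on. Written with pairings, the definition avoids evaluating polynomials at matrices.
\<close>

definition window :: "int poly \<Rightarrow> int poly \<Rightarrow> int vec" where
  "window p f = vec (degree p) (\<lambda>i. pairing (\<lambda>j. impulse_response p (j + i)) f)"

lemma window_carrier [simp]: "window p f \<in> carrier_vec (degree p)"
  by (simp add: window_def)

lemma window_add: "window p (f + g) = window p f + window p g"
  by (auto simp: window_def pairing_add)

lemma window_diff: "window p (f - g) = window p f - window p g"
  by (auto simp: window_def pairing_diff)

lemma window_mult_modulus:
  assumes "lead_coeff p = 1" "degree p > 0"
  shows "window p (g * p) = 0\<^sub>v (degree p)"
  using pairing_impulse_response[OF assms] by (auto simp: window_def)

text \<open>
  Multiplication by \<open>X\<close> moves the window one place along the sequence. The companion matrix does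
  the same: its upper rows drop the first entry, and its last row computes the next value from the
  recurrence.
\<close>

lemma window_shift:
  assumes "lead_coeff p = 1" "degree p > 0"
  shows "window p (monom 1 1 * f) = companion p *\<^sub>v window p f"
proof (rule eq_vecI)
  fix i assume "i < dim_vec (companion p *\<^sub>v window p f)"
  hence i: "i < degree p" by (simp add: companion_def)
  let ?w = "\<lambda>m. pairing (\<lambda>j. impulse_response p (j + m)) f"
  have lhs: "window p (monom 1 1 * f) $ i = ?w (Suc i)"
    using i by (simp add: window_def pairing_monom_mult)
  have "(\<Sum>j\<le>degree p. coeff p j * ?w j) = pairing (\<lambda>j. impulse_response p (j + 0)) (f * p)"
  proof -
    have "pairing (impulse_response p) (monom c j * f) = c * ?w j" for c j
      using pairing_smult[of _ c "monom 1 j * f"]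
      by (simp add: pairing_monom_mult smult_monom flip: mult_smult_left)
    moreover have "f * p = (\<Sum>j\<le>degree p. monom (coeff p j) j * f)"
      by (subst poly_as_sum_of_monoms[of p, symmetric]) (simp add: sum_distrib_left mult.commute)
    ultimately show ?thesis by (simp add: pairing_sum)
  qed
  also have "\<dots> = 0" using pairing_impulse_response[OF assms, of 0] by simp
  finally have "(\<Sum>j<degree p. coeff p j * ?w j) + ?w (degree p) = 0"
    using assms by (simp add: lessThan_Suc_atMost [symmetric])
  hence "?w (Suc i) = (companion p *\<^sub>v window p f) $ i"
    using i unfolding companion_mult_vec[OF window_carrier i]
    by (cases "i = degree p - 1") (auto simp: window_def)
  thus "window p (monom 1 1 * f) $ i = (companion p *\<^sub>v window p f) $ i"
    using lhs by simp
qed (simp add: window_def companion_def)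

text \<open>
  The Horner polynomials \<open>poly_shift (Suc j) p\<close>, the integral parts of \<open>p / X\<^sup>j\<^sup>+\<^sup>1\<close>, form for
  monic \<open>p\<close> the basis of \<open>\<int>[X]/(p)\<close> in which multiplication by \<open>X\<close> has the companion matrix
  itself as its matrix; the basis of the powers of \<open>X\<close> would give the transpose.
\<close>

definition horner_combination :: "int poly \<Rightarrow> int vec \<Rightarrow> int poly" where
  "horner_combination p x = (\<Sum>j<degree p. smult (x $ j) (poly_shift (Suc j) p))"

lemma poly_shift_conv_Suc: "poly_shift j p = pCons (coeff p j) (poly_shift (Suc j) p)"
  by (rule poly_eqI) (simp add: coeff_poly_shift coeff_pCons split: nat.split)

lemma poly_shift_degree: "poly_shift (degree p) p = [:lead_coeff p:]"
  by (rule poly_eqI) (auto simp: coeff_poly_shift coeff_pCons coeff_eq_0 split: nat.split)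

lemma horner_combination_add:
  assumes "x \<in> carrier_vec (degree p)" "y \<in> carrier_vec (degree p)"
  shows "horner_combination p (x + y) = horner_combination p x + horner_combination p y"
  using assms by (simp add: horner_combination_def smult_add_left sum.distrib)

lemma horner_combination_minus:
  assumes "x \<in> carrier_vec (degree p)" "y \<in> carrier_vec (degree p)"
  shows "horner_combination p (x - y) = horner_combination p x - horner_combination p y"
  using assms by (simp add: horner_combination_def smult_diff_left sum_subtractf)

text \<open>
  The \<open>j\<close>-th unit vector goes to the \<open>(j - 1)\<close>-st one minus \<open>coeff p j\<close> times the last one, which
  is Horner's recursion \<open>X h\<^sub>j = h\<^sub>j\<^sub>-\<^sub>1 - coeff p j\<close> for \<open>h\<^sub>j = poly_shift (Suc j) p\<close>.
  At \<open>j = 0\<close> the recursion ends in \<open>p\<close> itself; this is the correction term.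
\<close>

lemma horner_combination_companion:
  assumes "lead_coeff p = 1" "degree p > 0" and x: "x \<in> carrier_vec (degree p)"
  shows "horner_combination p (companion p *\<^sub>v x) =
    monom 1 1 * horner_combination p x - smult (x $ 0) p"
proof -
  obtain r where r: "degree p = Suc r" using assms(2) by (cases "degree p") auto
  let ?h = "\<lambda>j. poly_shift j p"
  have top: "?h (Suc r) = 1"
    using poly_shift_degree[of p] assms(1) by (simp add: r one_pCons)
  have X: "monom 1 1 * ?h (Suc j) = ?h j - [:coeff p j:]" for j
    by (subst (2) poly_shift_conv_Suc) (simp add: monom_Suc monom_0)
  have "horner_combination p (companion p *\<^sub>v x) =
      (\<Sum>j<r. smult (x $ Suc j) (?h (Suc j))) + smult (- (\<Sum>j<Suc r. coeff p j * x $ j)) 1"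
    unfolding horner_combination_def r sum.lessThan_Suc top
    using companion_mult_vec[OF x] by (simp only: r) simp
  also have "(\<Sum>j<r. smult (x $ Suc j) (?h (Suc j))) =
      (\<Sum>j<Suc r. smult (x $ j) (?h j)) - smult (x $ 0) p"
    by (simp add: sum.lessThan_Suc_shift del: sum.lessThan_Suc)
  also have "smult (- (\<Sum>j<Suc r. coeff p j * x $ j)) 1 =
      - (\<Sum>j<Suc r. smult (x $ j) [:coeff p j:])"
    by (rule poly_eqI)
      (simp add: one_pCons coeff_sum coeff_pCons mult.commute del: sum.lessThan_Suc
        split: nat.split)
  finally show ?thesis
    unfolding horner_combination_def sum_distrib_left r
    by (simp add: X[unfolded One_nat_def] smult_diff_right sum_subtractf del: sum.lessThan_Suc)
qed

text \<open>
  Horner's polynomials and the shifted impulse responses are dual bases. The induction on the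
  shift \<open>i\<close> slides along the diagonal: one more shift is compensated by one more Horner step,
  as long as the intermediate value of the impulse response is \<open>0\<close>, and below the diagonal the
  descent reaches \<open>p\<close>, which pairs to \<open>0\<close>.
\<close>

lemma pairing_impulse_response_horner:
  assumes "lead_coeff p = 1" "i < degree p"
  shows "pairing (\<lambda>t. impulse_response p (t + i)) (poly_shift (Suc j) p) = (if i = j then 1 else 0)"
  using assms(2)
proof (induction i arbitrary: j)
  case 0
  then obtain r where r: "degree p = Suc r" by (cases "degree p") auto
  have "degree (poly_shift (Suc j) p) \<le> r"
    by (rule degree_le) (use r in \<open>auto simp: coeff_poly_shift coeff_eq_0\<close>)
  hence "pairing (\<lambda>t. impulse_response p (t + 0)) (poly_shift (Suc j) p) =
      (\<Sum>t\<le>r. coeff p (Suc (t + j)) * impulse_response p t)"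
    by (simp add: pairing_eq_sum coeff_poly_shift)
  also have "\<dots> = coeff p (Suc (r + j))"
    using impulse_response_initial(1)[of _ p] impulse_response_initial(2)[of p] r by (simp flip: lessThan_Suc_atMost)
  finally show ?case using assms(1) r by (auto simp: coeff_eq_0)
next
  case (Suc i)
  have "pairing (\<lambda>t. impulse_response p (t + i)) (poly_shift j p) =
      coeff p j * impulse_response p i
      + pairing (\<lambda>t. impulse_response p (t + Suc i)) (poly_shift (Suc j) p)"
    by (subst poly_shift_conv_Suc) (simp add: pairing_pCons)
  moreover have "impulse_response p i = 0"
    using Suc.prems by (intro impulse_response_initial) simp
  moreover have "pairing (\<lambda>t. impulse_response p (t + i)) (poly_shift j p) =
      (if Suc i = j then 1 else 0)"
  proof (cases j)
    case 0
    thus ?thesis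
      using pairing_impulse_response[of p i 1] assms(1) Suc.prems by simp
  next
    case (Suc j')
    with Suc.IH Suc.prems show ?thesis by simp
  qed
  ultimately show ?case by simp
qed

lemma window_horner:
  assumes "lead_coeff p = 1" and x: "x \<in> carrier_vec (degree p)"
  shows "window p (horner_combination p x) = x"
proof (rule eq_vecI)
  fix i assume "i < dim_vec x"
  with x have i: "i < degree p" by simp
  have "window p (horner_combination p x) $ i =
      (\<Sum>j<degree p. x $ j * (if i = j then 1 else 0))"
    using i by (simp add: window_def horner_combination_def pairing_sum pairing_smult
        pairing_impulse_response_horner[OF assms(1)])
  thus "window p (horner_combination p x) $ i = x $ i" using i
    by (simp add: if_distrib sum.delta cong: if_cong)
qed (use x in \<open>simp add: window_def\<close>)

text \<open>
  The composite fixes \<open>1\<close>, the Horner polynomial of the last unit vector, and commutes with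
  multiplication by \<open>X\<close> modulo \<open>p\<close>; hence it is the identity on \<open>\<int>[X]/(p)\<close>.
\<close>

lemma horner_combination_window:
  assumes "lead_coeff p = 1" "degree p > 0"
  shows "quot_cong n p (horner_combination p (window p f)) f"
proof (induction f)
  case 0
  show ?case by (simp add: horner_combination_def window_def)
next
  case (pCons c f)
  obtain r where r: "degree p = Suc r" using assms(2) by (cases "degree p") auto
  have top: "poly_shift (Suc r) p = 1"
    using poly_shift_degree[of p] assms(1) by (simp add: r one_pCons)
  have "horner_combination p (window p [:c:]) =
      (\<Sum>j<Suc r. smult (c * impulse_response p j) (poly_shift (Suc j) p))"
    by (simp add: horner_combination_def window_def r pairing_pCons)
  also have "\<dots> = [:c:]"
    using impulse_response_initial(1)[of _ p] impulse_response_initial(2)[of p] r by (simp add: top)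
  finally have const: "horner_combination p (window p [:c:]) = [:c:]" .
  have split: "pCons c f = [:c:] + monom 1 1 * f" by (simp add: monom_Suc monom_0)
  have "horner_combination p (window p (pCons c f)) =
      [:c:] + (monom 1 1 * horner_combination p (window p f) - smult (window p f $ 0) p)"
    unfolding split window_add window_shift[OF assms]
    by (subst horner_combination_add)
      (simp_all add: const horner_combination_companion[OF assms] mult_mat_vec_carrier[of _ _ "degree p"])
  also have "quot_cong n p \<dots> ([:c:] + (monom 1 1 * f - [:window p f $ 0:] * 0))"
    using quot_cong_mult[OF quot_cong_refl quot_cong_generators(2), of n p "[:window p f $ 0:]"]
    by (intro quot_cong_add quot_cong_diff quot_cong_mult quot_cong_refl pCons.IH) simp_all
  also have "\<dots> = pCons c f" by (simp add: split)
  finally show ?case .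
qed

lemma companion_power_carrier [simp]:
  "companion p ^\<^sub>m n \<in> carrier_mat (degree p) (degree p)"
  by (intro pow_carrier_mat companion_carrier)

lemma companion_power_mult_vec_Suc:
  assumes "x \<in> carrier_vec (degree p)"
  shows "companion p ^\<^sub>m Suc n *\<^sub>v x = companion p ^\<^sub>m n *\<^sub>v (companion p *\<^sub>v x)"
  using assms
  by (simp add: assoc_mult_mat_vec[of _ "degree p" "degree p" _ "degree p"])

lemma window_shift_power:
  assumes "lead_coeff p = 1" "degree p > 0"
  shows "window p (monom 1 n * f) = companion p ^\<^sub>m n *\<^sub>v window p f"
proof (induction n arbitrary: f)
  case (Suc n)
  have "monom 1 (Suc n) * f = monom 1 n * (monom 1 1 * f)"
    by (simp add: mult_monom flip: mult.assoc)
  thus ?case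
    by (simp only: Suc.IH window_shift[OF assms] companion_power_mult_vec_Suc[OF window_carrier])
qed (simp add: monom_0 flip: one_pCons, simp add: companion_def window_def)

lemma horner_combination_companion_power:
  assumes "lead_coeff p = 1" "degree p > 0" and "x \<in> carrier_vec (degree p)"
  shows "quot_cong n' p (horner_combination p (companion p ^\<^sub>m n *\<^sub>v x))
           (monom 1 n * horner_combination p x)"
  using assms(3)
proof (induction n arbitrary: x)
  case (Suc n)
  have Cx: "companion p *\<^sub>v x \<in> carrier_vec (degree p)"
    using Suc.prems by (simp add: mult_mat_vec_carrier[of _ _ "degree p"])
  have "quot_cong n' p (horner_combination p (companion p ^\<^sub>m Suc n *\<^sub>v x))
      (monom 1 n * horner_combination p (companion p *\<^sub>v x))"
    unfolding companion_power_mult_vec_Suc[OF Suc.prems] by (rule Suc.IH[OF Cx])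
  also have "quot_cong n' p \<dots> (monom 1 n * (monom 1 1 * horner_combination p x - [:x $ 0:] * 0))"
    unfolding horner_combination_companion[OF assms(1,2) Suc.prems]
    using quot_cong_mult[OF quot_cong_refl quot_cong_generators(2), of n' p "[:x $ 0:]"]
    by (intro quot_cong_mult quot_cong_diff quot_cong_refl) simp_all
  also have "\<dots> = monom 1 (Suc n) * horner_combination p x"
    by (simp add: mult_monom flip: mult.assoc)
  finally show ?case .
qed (simp add: monom_0 flip: one_pCons, simp add: companion_def)

text \<open>
  In Horner's basis, \<open>X\<close> acts on \<open>\<int>[X]/(p)\<close> as the companion matrix \<open>A\<close>, so the ideal generated
  by \<open>X\<^sup>n - 1\<close> corresponds to the image of \<open>A\<^sup>n - I\<close>.
\<close>

lemma coker_companion_power: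
  assumes "lead_coeff p = 1" "degree p > 0"
  shows "coker (companion p ^\<^sub>m n - 1\<^sub>m (degree p)) \<cong> quotient_group (relation_ideal n p)"
proof (rule coker_iso_quotient_group[where b = "horner_combination p" and d = "window p"])
  let ?M = "companion p ^\<^sub>m n - 1\<^sub>m (degree p)"
  show M: "?M \<in> carrier_mat (degree p) (degree p)"
    by (rule minus_carrier_mat) simp
  have M_mult: "?M *\<^sub>v y = companion p ^\<^sub>m n *\<^sub>v y - y" if "y \<in> carrier_vec (degree p)" for y
    using that by (simp add: minus_mult_distrib_mat_vec[of _ "degree p" "degree p"])
  show "horner_combination p (?M *\<^sub>v y) \<in> relation_ideal n p"
    if y: "y \<in> carrier_vec (degree p)" for y
  proof -
    have "horner_combination p (?M *\<^sub>v y) =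
        horner_combination p (companion p ^\<^sub>m n *\<^sub>v y) - horner_combination p y"
      unfolding M_mult[OF y] using y
      by (intro horner_combination_minus) (simp_all add: mult_mat_vec_carrier[of _ _ "degree p"])
    also have "quot_cong n p \<dots> (monom 1 n * horner_combination p y - horner_combination p y)"
      by (intro quot_cong_diff horner_combination_companion_power assms y quot_cong_refl)
    also have "quot_cong n p \<dots> (1 * horner_combination p y - horner_combination p y)"
      by (intro quot_cong_diff quot_cong_mult quot_cong_generators quot_cong_refl)
    finally show ?thesis by (simp add: quot_cong_def)
  qed
  show "\<exists>y\<in>carrier_vec (degree p). window p f = ?M *\<^sub>v y" if f: "f \<in> relation_ideal n p" for f
  proof -
    obtain f1 g where "f = f1 * (monom 1 n - 1) + g * p"
      using f unfolding relation_ideal_def by blast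
    hence "f = (monom 1 n * f1 - f1) + g * p" by (simp add: algebra_simps)
    hence "window p f = ?M *\<^sub>v window p f1"
      by (simp add: window_add window_diff window_mult_modulus[OF assms]
          window_shift_power[OF assms] M_mult)
        (auto simp: companion_def window_def)
    thus ?thesis using window_carrier by blast
  qed
  show "horner_combination p (window p f) - f \<in> relation_ideal n p" for f
    using horner_combination_window[OF assms] by (simp add: quot_cong_def)
  show "\<exists>y\<in>carrier_vec (degree p).
      x = window p (horner_combination p x) + ?M *\<^sub>v y" if x: "x \<in> carrier_vec (degree p)" for x
  proof (rule bexI)
    show "x = window p (horner_combination p x) + ?M *\<^sub>v 0\<^sub>v (degree p)"
      using x M by (auto simp: window_horner[OF assms(1)])
  qed simp
qed (simp_all add: relation_ideal_0 relation_ideal_add relation_ideal_uminus horner_combination_add)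

section \<open>Polynomials modulo \<open>X\<^sup>n - 1\<close>\<close>

lemma quot_cong_monom:
  assumes "a mod n = b mod n"
  shows "quot_cong n p (monom c a) (monom c b)"
proof -
  have red: "quot_cong n p (monom c a) (monom c (a mod n))" for a
  proof -
    have pow: "quot_cong n p (monom 1 n ^ q) 1" for q
    proof (induction q)
      case (Suc q)
      from quot_cong_mult[OF quot_cong_generators(1) Suc] show ?case by simp
    qed simp
    have "monom c a = monom c (a mod n) * monom 1 n ^ (a div n)"
      by (simp add: monom_power mult_monom)
    also have "quot_cong n p \<dots> (monom c (a mod n) * 1)"
      by (intro quot_cong_mult pow quot_cong_refl)
    finally show ?thesis by simp
  qed
  show ?thesis using red[of a] red[of b] assms by (metis quot_cong_sym quot_cong_trans)
qed

lemma quot_cong_0_imp: "quot_cong n 0 f g \<Longrightarrow> quot_cong n p f g"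
  unfolding quot_cong_def relation_ideal_def by (auto, metis add_0_right mult_zero_left)

text \<open>
  The \<open>i\<close>-th coordinate of \<open>f\<close> in \<open>\<int>[X]/(X\<^sup>n - 1)\<close>, with respect to the basis of powers of \<open>X\<close>.
  It is periodic in \<open>i\<close>, so that rotations of the index need no case distinction.
\<close>

definition residue_sum :: "nat \<Rightarrow> int poly \<Rightarrow> nat \<Rightarrow> int" where
  "residue_sum n f i = pairing (\<lambda>j. of_bool (j mod n = i mod n)) f"

lemma residue_sum_add: "residue_sum n (f + g) i = residue_sum n f i + residue_sum n g i"
  by (simp add: residue_sum_def pairing_add)

lemma residue_sum_diff: "residue_sum n (f - g) i = residue_sum n f i - residue_sum n g i"
  by (simp add: residue_sum_def pairing_diff)

lemma residue_sum_smult: "residue_sum n (smult c f) i = c * residue_sum n f i"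
  by (simp add: residue_sum_def pairing_smult)

lemma residue_sum_mod: "residue_sum n f (i mod n) = residue_sum n f i"
  by (simp add: residue_sum_def)

lemma residue_sum_shift:
  assumes "n dvd m + m'"
  shows "residue_sum n f ((i + m) mod n) = residue_sum n (monom 1 m' * f) i"
proof -
  have "j mod n = (i + m) mod n \<longleftrightarrow> (j + m') mod n = i mod n" for j
  proof -
    have "[i + (m + m') = i] (mod n)"
      using assms by (metis add.right_neutral cong_0_iff cong_add_lcancel_nat)
    hence "[j = i + m] (mod n) \<longleftrightarrow> [j + m' = i] (mod n)"
      by (metis add.assoc cong_add_rcancel_nat cong_sym cong_trans)
    thus ?thesis by (simp add: cong_def)
  qed
  thus ?thesis by (simp add: residue_sum_def pairing_monom_mult)
qed

lemma residue_sum_cong: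
  assumes "quot_cong n 0 f g"
  shows "residue_sum n f i = residue_sum n g i"
proof -
  obtain h where h: "f - g = h * (monom 1 n - 1)"
    using assms unfolding quot_cong_def relation_ideal_def by auto
  have "residue_sum n (h * (monom 1 n - 1)) i = residue_sum n (monom 1 n * h) i - residue_sum n h i"
    by (simp add: algebra_simps residue_sum_diff)
  also have "\<dots> = 0" using residue_sum_shift[of n 0 n h i] by (simp add: residue_sum_mod)
  finally show ?thesis by (simp add: residue_sum_diff flip: h)
qed

text \<open>
  The inverse of \<open>residue_sum\<close>: it identifies functions on \<open>\<int>/n\<close> with the ring
  \<open>\<int>[X]/(X\<^sup>n - 1)\<close>. Rotating a function amounts to multiplying by a power of \<open>X\<close>.
\<close>

definition cyclic_poly :: "nat \<Rightarrow> (nat \<Rightarrow> int) \<Rightarrow> int poly" where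
  "cyclic_poly n z = (\<Sum>i<n. monom (z i) i)"

lemma cyclic_poly_0: "cyclic_poly n (\<lambda>i. 0) = 0"
  by (simp add: cyclic_poly_def)

lemma cyclic_poly_add: "cyclic_poly n (\<lambda>i. z i + z' i) = cyclic_poly n z + cyclic_poly n z'"
  by (simp add: cyclic_poly_def sum.distrib flip: add_monom)

lemma cyclic_poly_diff: "cyclic_poly n (\<lambda>i. z i - z' i) = cyclic_poly n z - cyclic_poly n z'"
  by (simp add: cyclic_poly_def sum_subtractf flip: diff_monom)

lemma cyclic_poly_mult: "cyclic_poly n (\<lambda>i. c * z i) = smult c (cyclic_poly n z)"
proof -
  have "smult c (\<Sum>i\<in>A. f i) = (\<Sum>i\<in>A. smult c (f i))" for f :: "nat \<Rightarrow> int poly" and A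
    by (induction A rule: infinite_finite_induct) (simp_all add: smult_add_right)
  thus ?thesis by (simp add: cyclic_poly_def smult_monom)
qed

lemma residue_sum_cyclic_poly:
  assumes "i < n"
  shows "residue_sum n (cyclic_poly n z) i = z i"
proof -
  have "residue_sum n (cyclic_poly n z) i = (\<Sum>j<n. z j * of_bool (j = i))"
    using assms by (simp add: residue_sum_def cyclic_poly_def pairing_sum pairing_monom)
  also have "\<dots> = z i" using assms by (simp add: of_bool_def if_distrib cong: if_cong)
  finally show ?thesis .
qed

lemma cyclic_shift_inverse:
  assumes "n dvd m + m'" "i < (n::nat)"
  shows "((i + m) mod n + m') mod n = i"
proof -
  obtain q where "m + m' = n * q" using assms by (elim dvdE)
  hence "((i + m) mod n + m') mod n = (i + n * q) mod n"
    by (simp add: mod_simps add.assoc)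
  thus ?thesis using assms by simp
qed

lemma cyclic_poly_shift:
  assumes "n dvd m + m'"
  shows "quot_cong n p (cyclic_poly n (\<lambda>i. z ((i + m) mod n))) (monom 1 m' * cyclic_poly n z)"
proof -
  have "n dvd m' + m" using assms by (simp add: add.commute)
  hence "cyclic_poly n (\<lambda>i. z ((i + m) mod n)) = (\<Sum>i<n. monom (z i) ((i + m') mod n))"
    unfolding cyclic_poly_def
    using cyclic_shift_inverse[OF assms] cyclic_shift_inverse[of n m' m]
    by (intro sum.reindex_bij_witness[where j = "\<lambda>i. (i + m) mod n"
          and i = "\<lambda>i. (i + m') mod n"]) auto
  also have "quot_cong n p \<dots> (\<Sum>i<n. monom (z i) (i + m'))"
    by (intro quot_cong_sum quot_cong_monom) simp
  also have "\<dots> = monom 1 m' * cyclic_poly n z"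
    by (simp add: cyclic_poly_def sum_distrib_left mult_monom add.commute)
  finally show ?thesis .
qed

lemma cyclic_poly_residue_sum:
  assumes "n > 0"
  shows "quot_cong n p (cyclic_poly n (residue_sum n f)) f"
proof (induction f)
  case 0
  show ?case by (simp add: residue_sum_def cyclic_poly_0)
next
  case (pCons c f)
  have split: "pCons c f = [:c:] + monom 1 1 * f" by (simp add: monom_Suc monom_0)
  have "cyclic_poly n (residue_sum n [:c:]) = (\<Sum>i<n. if i = 0 then [:c:] else 0)"
    unfolding cyclic_poly_def
    by (intro sum.cong) (auto simp: residue_sum_def pairing_pCons monom_0)
  hence const: "cyclic_poly n (residue_sum n [:c:]) = [:c:]" using assms by simp
  have n: "n dvd (n - 1) + 1" using assms by simp
  have "residue_sum n (g + h) = (\<lambda>i. residue_sum n g i + residue_sum n h i)" for g h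
    by (simp add: residue_sum_add fun_eq_iff)
  hence "cyclic_poly n (residue_sum n (pCons c f)) =
      [:c:] + cyclic_poly n (\<lambda>i. residue_sum n f ((i + (n - 1)) mod n))"
    unfolding residue_sum_shift[OF n] split
    by (simp only: cyclic_poly_add const)
  also have "quot_cong n p \<dots> ([:c:] + monom 1 1 * cyclic_poly n (residue_sum n f))"
    by (intro quot_cong_add cyclic_poly_shift n quot_cong_refl)
  also have "quot_cong n p \<dots> ([:c:] + monom 1 1 * f)"
    by (intro quot_cong_add quot_cong_mult quot_cong_refl pCons.IH)
  finally show ?case by (simp only: split)
qed

text \<open>
  The Laurent polynomial \<open>3 - X\<^sup>m - X\<^sup>-\<^sup>m\<close> modulo \<open>X\<^sup>n - 1\<close>. The exponent \<open>m * (n - 1)\<close> represents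
  \<open>-m\<close>, for which the truncated subtraction \<open>n - m\<close> would fail when \<open>m\<close> exceeds \<open>n\<close>. Neighbours in
  the graph are written in the same way below.
\<close>

definition cycle_poly :: "nat \<Rightarrow> nat \<Rightarrow> int poly" where
  "cycle_poly n m = [:3:] - monom 1 m - monom 1 (m * (n - 1))"

lemma dvd_shift:
  fixes n m :: nat
  assumes "n > 0"
  shows "n dvd m + m * (n - 1)" "n dvd m * (n - 1) + m"
proof -
  have "m + m * (n - 1) = n * m" using assms by (cases n) auto
  thus "n dvd m + m * (n - 1)" "n dvd m * (n - 1) + m" by (simp_all add: add.commute)
qed

lemma shifted_poly_I_laurent:
  assumes "k > 0" "l > 0"
  shows "shifted_poly (I_laurent k l) =
    ([:3:] * monom 1 k - monom 1 (2 * k) - 1) * ([:3:] * monom 1 l - monom 1 (2 * l) - 1)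
      - monom 1 (k + l)"
proof (rule poly_eqI)
  fix j
  let ?P = "I_laurent k l"
  have numeral_times: "3 * zpow i = Poly_Mapping.single i 3" for i
  proof -
    have "3 * zpow i = zpow i + zpow i + zpow i" by simp
    thus ?thesis by (simp add: zpow_def flip: single_add)
  qed
  have "?P = 8 - 3 * zpow (int k) - 3 * zpow (- int k) - 3 * zpow (int l) - 3 * zpow (- int l)
      + zpow (int k) * zpow (int l) + zpow (int k) * zpow (- int l)
      + zpow (- int k) * zpow (int l) + zpow (- int k) * zpow (- int l)"
    by (simp add: I_laurent_def algebra_simps)
  hence expand: "Poly_Mapping.lookup ?P i =
      (8 when i = 0) - (3 when int k = i) - (3 when - int k = i)
      - (3 when int l = i) - (3 when - int l = i)
      + (1 when int k + int l = i) + (1 when int k - int l = i)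
      + (1 when - int k + int l = i) + (1 when - int k - int l = i)" for i
    unfolding numeral_times
    by (simp add: zpow_def mult_single lookup_add lookup_minus lookup_single lookup_numeral)
  let ?rhs = "monom 8 (k + l) - monom 3 (2 * k + l) - monom 3 l - monom 3 (k + 2 * l) - monom 3 k
     + monom 1 (2 * k + 2 * l) + monom 1 (2 * k) + monom 1 (2 * l) + (monom 1 0 :: int poly)"
  have "coeff ?rhs j = (if j \<le> 2 * (k + l)
      then Poly_Mapping.lookup ?P (- int (k + l) + int j) else 0)"
  proof (cases "j \<le> 2 * (k + l)")
    case True
    let ?i = "- int (k + l) + int j"
    have conv: "(c when e = ?i) = coeff (monom c m) j" if "e + int (k + l) = int m" for c e :: int and m
    proof -
      have "e = ?i \<longleftrightarrow> m = j" using that by linarith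
      thus ?thesis by (simp add: when_def)
    qed
    have "((8::int) when ?i = 0) = (8 when 0 = ?i)"
      by (rule arg_cong[where f = "(when) 8", OF eq_commute])
    also have "\<dots> = coeff (monom 8 (k + l)) j"
      by (rule conv) simp
    finally have "((8::int) when ?i = 0) = coeff (monom 8 (k + l)) j" .
    moreover have "((3::int) when int k = ?i) = coeff (monom 3 (2 * k + l)) j"
      "((3::int) when - int k = ?i) = coeff (monom 3 l) j"
      "((3::int) when int l = ?i) = coeff (monom 3 (k + 2 * l)) j"
      "((3::int) when - int l = ?i) = coeff (monom 3 k) j"
      "((1::int) when int k + int l = ?i) = coeff (monom 1 (2 * k + 2 * l)) j"
      "((1::int) when int k - int l = ?i) = coeff (monom 1 (2 * k)) j"
      "((1::int) when - int k + int l = ?i) = coeff (monom 1 (2 * l)) j"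
      "((1::int) when - int k - int l = ?i) = coeff (monom 1 0) j"
      by (rule conv, simp)+
    ultimately show ?thesis
      using True by (simp only: expand coeff_add coeff_diff if_True)
  next
    case False
    hence "coeff (monom c m) j = 0" if "m \<le> 2 * k + 2 * l" for m and c :: int
      using that by simp
    moreover have "j \<noteq> 0" using False by simp
    ultimately show ?thesis using False by (simp del: coeff_monom)
  qed
  moreover have "([:3:] * monom 1 k - monom 1 (2 * k) - 1) * ([:3:] * monom 1 l - monom 1 (2 * l) - 1)
      - monom 1 (k + l) = ?rhs"
  proof -
    define a b :: "int poly" where "a = monom 1 k" and "b = monom 1 l"
    have split: "monom c (i + j) = monom c i * monom 1 j"
      "monom c (2 * i) = monom c i * monom 1 i" for c :: int and i j
      by (simp_all add: mult_monom mult_2)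
    have scalar: "monom c k = of_int c * a" "monom c l = of_int c * b" for c
      unfolding a_def b_def by (simp_all add: of_int_poly smult_monom)
    have "[:3:] = (3 :: int poly)" by (simp add: numeral_poly)
    thus ?thesis unfolding split scalar by (simp add: algebra_simps)
  qed
  ultimately show "coeff (shifted_poly ?P) j = coeff (([:3:] * monom 1 k - monom 1 (2 * k) - 1)
      * ([:3:] * monom 1 l - monom 1 (2 * l) - 1) - monom 1 (k + l)) j"
    by (simp only: coeff_shifted_poly I_laurent_exponents[OF assms])
qed

text \<open>
  The Laurent polynomial of the graph and the polynomial of its companion matrix differ by the
  unit \<open>X\<^sup>k\<^sup>+\<^sup>l\<close> of \<open>\<int>[X]/(X\<^sup>n - 1)\<close>. Congruence modulo \<open>X\<^sup>n - 1\<close> alone is the case \<open>p = 0\<close>.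
\<close>

lemma cycle_poly_product:
  assumes "n > 0" "k > 0" "l > 0"
  shows "quot_cong n 0 (monom 1 (k + l) * (cycle_poly n l * cycle_poly n k - 1))
           (shifted_poly (I_laurent k l))"
proof -
  have shift: "quot_cong n 0 (monom 1 m * cycle_poly n m) ([:3:] * monom 1 m - monom 1 (2 * m) - 1)" for m
  proof -
    have "monom 1 m * cycle_poly n m = [:3:] * monom 1 m - monom 1 (2 * m) - monom 1 (m + m * (n - 1))"
      by (simp add: cycle_poly_def algebra_simps mult_monom smult_monom mult_2_right)
    also have "quot_cong n 0 \<dots> ([:3:] * monom 1 m - monom 1 (2 * m) - monom 1 0)"
      using dvd_shift[OF assms(1), of m]
      by (intro quot_cong_diff quot_cong_refl quot_cong_monom) auto
    finally show ?thesis by (simp add: monom_0 one_pCons)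
  qed
  have "monom 1 (k + l) * (cycle_poly n l * cycle_poly n k - 1) =
      (monom 1 k * cycle_poly n k) * (monom 1 l * cycle_poly n l) - monom 1 (k + l)"
  proof -
    have "monom 1 (k + l) = monom 1 k * (monom 1 l :: int poly)" by (simp add: mult_monom)
    thus ?thesis by (simp add: algebra_simps)
  qed
  also have "quot_cong n 0 \<dots> (shifted_poly (I_laurent k l))"
    unfolding shifted_poly_I_laurent[OF assms(2,3)]
    by (intro quot_cong_diff quot_cong_mult shift quot_cong_refl)
  finally show ?thesis .
qed

lemma cycle_poly_product_cong_1:
  assumes "n > 0" "k > 0" "l > 0"
  shows "quot_cong n (shifted_poly (I_laurent k l)) (cycle_poly n l * cycle_poly n k - 1) 0"
proof -
  let ?p = "shifted_poly (I_laurent k l)" and ?D = "cycle_poly n l * cycle_poly n k - 1"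
  let ?m = "k + l"
  have "monom 1 0 * ?D = ?D" by (simp add: monom_0 flip: one_pCons)
  moreover have "quot_cong n ?p (monom 1 0 * ?D) (monom 1 (?m + ?m * (n - 1)) * ?D)"
    using dvd_shift[OF assms(1), of ?m]
    by (intro quot_cong_mult quot_cong_refl quot_cong_monom) auto
  ultimately have "quot_cong n ?p ?D (monom 1 (?m * (n - 1)) * (monom 1 ?m * ?D))"
    by (simp add: mult_monom add.commute flip: mult.assoc)
  also have "quot_cong n ?p \<dots> (monom 1 (?m * (n - 1)) * ?p)"
    by (intro quot_cong_mult quot_cong_refl quot_cong_0_imp[OF cycle_poly_product] assms)
  also have "quot_cong n ?p \<dots> (monom 1 (?m * (n - 1)) * 0)"
    by (intro quot_cong_mult quot_cong_refl quot_cong_generators)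
  finally show ?thesis by simp
qed

section \<open>The Laplacian of the graph \<open>I(n,k,l)\<close>\<close>

text \<open>
  The Laplacian as an operator on functions on the vertices, which makes it independent of the
  enumeration of the vertices.
\<close>

fun I_operator :: "nat \<Rightarrow> nat \<Rightarrow> nat \<Rightarrow> (I_vertex \<Rightarrow> int) \<Rightarrow> I_vertex \<Rightarrow> int" where
  "I_operator n k l y (U i) =
     3 * y (U i) - y (U ((i + l) mod n)) - y (U ((i + l * (n - 1)) mod n)) - y (V i)"
| "I_operator n k l y (V i) =
     3 * y (V i) - y (V ((i + k) mod n)) - y (V ((i + k * (n - 1)) mod n)) - y (U i)"

definition coord_vec :: "'a list \<Rightarrow> ('a \<Rightarrow> int) \<Rightarrow> int vec" where
  "coord_vec vs y = vec (length vs) (\<lambda>j. y (vs ! j))"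

lemma coord_vec_carrier [simp]: "coord_vec vs y \<in> carrier_vec (length vs)"
  by (simp add: coord_vec_def)

lemma coord_vec_add: "coord_vec vs y + coord_vec vs z = coord_vec vs (\<lambda>v. y v + z v)"
  by (auto simp: coord_vec_def)

lemma coord_vec_cong:
  "(\<And>v. v \<in> set vs \<Longrightarrow> y v = z v) \<Longrightarrow> coord_vec vs y = coord_vec vs z"
  by (auto simp: coord_vec_def)

lemma coord_vec_exhaust:
  assumes "distinct vs" "x \<in> carrier_vec (length vs)"
  obtains y where "x = coord_vec vs y"
proof
  show "x = coord_vec vs (\<lambda>v. x $ (THE j. j < length vs \<and> vs ! j = v))"
    using assms by (intro eq_vecI)
      (auto simp: coord_vec_def nth_eq_iff_index_eq intro!: arg_cong[where f = "\<lambda>j. x $ j"]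
        the_equality[symmetric])
qed

lemma sum_enumeration:
  assumes "distinct vs"
  shows "(\<Sum>j<length vs. h (vs ! j)) = sum h (set vs)"
  using sum.reindex_bij_betw[OF bij_betw_nth[OF assms refl refl], of h] by simp

lemma sum_I_vertices:
  assumes "vertex_enumeration vs (I_graph n k l)"
  shows "(\<Sum>j<length vs. h (vs ! j)) = (\<Sum>i<n. h (U i)) + (\<Sum>i<n. h (V i))"
proof -
  have "distinct vs" "set vs = U ` {..<n} \<union> V ` {..<n}"
    using assms by (auto simp: vertex_enumeration_def I_graph_def)
  thus ?thesis
    by (simp add: sum_enumeration) (subst sum.union_disjoint, auto simp: sum.reindex inj_on_def)
qed

lemma mod_shift_neq:
  fixes n m i :: nat
  assumes "\<not> n dvd m"
  shows "(i + m) mod n \<noteq> i"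
proof
  assume "(i + m) mod n = i"
  hence "[i + m = i + 0] (mod n)" by (metis add.right_neutral cong_def mod_mod_trivial)
  hence "n dvd m" by (simp only: cong_add_lcancel_nat cong_0_iff)
  with assms show False by simp
qed

lemma mod_shift_eq_iff:
  fixes n m i j :: nat
  assumes "i < n" "j < n"
  shows "(j + m) mod n = i \<longleftrightarrow> j = (i + m * (n - 1)) mod n"
  using cyclic_shift_inverse[OF dvd_shift(1), of n j m]
    cyclic_shift_inverse[OF dvd_shift(2), of n i m] assms by auto

text \<open>
  The unordered pair of \<open>i\<close> and \<open>j\<close> arises from the index \<open>a = i\<close> and from \<open>a = j\<close>. The two
  contributions add up because the indices are different, as there are no loops; if \<open>n = 2 m\<close>, both
  can occur and give the double edges.
\<close>

lemma card_rim_edges: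
  fixes n m i j :: nat
  assumes "inj c" "\<not> n dvd m" "i < n" "j < n"
  shows "card {a \<in> {..<n}. Upair (c a) (c ((a + m) mod n)) = Upair (c i) (c j)} =
    of_bool (j = (i + m) mod n) + of_bool (j = (i + m * (n - 1)) mod n)"
proof -
  have "{a \<in> {..<n}. Upair (c a) (c ((a + m) mod n)) = Upair (c i) (c j)} =
      {a. a = i \<and> j = (i + m) mod n} \<union> {a. a = j \<and> j = (i + m * (n - 1)) mod n}"
    using assms(3,4) mod_shift_eq_iff[OF assms(3,4), of m] by (auto simp: inj_eq[OF assms(1)])
  moreover have "card {a. a = x \<and> Q} = of_bool Q" for x :: nat and Q by (cases Q) auto
  moreover have "{a. a = i \<and> j = (i + m) mod n} \<inter> {a. a = j \<and> j = (i + m * (n - 1)) mod n} = {}"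
    using mod_shift_neq[OF assms(2), of i] by auto
  moreover have "finite {a. a = x \<and> Q}" for x :: nat and Q by simp
  ultimately show ?thesis by (simp add: card_Un_disjoint)
qed

lemma card_rim_edges_at:
  fixes n m i :: nat
  assumes "inj c" "\<not> n dvd m" "i < n"
  shows "card {a \<in> {..<n}. c i \<in> set_uprod (Upair (c a) (c ((a + m) mod n)))} = 2"
proof -
  let ?j = "(i + m * (n - 1)) mod n"
  have j: "?j < n" using assms by simp
  have "c i \<in> set_uprod (Upair (c a) (c ((a + m) mod n))) \<longleftrightarrow> a = i \<or> a = ?j" if "a < n" for a
    using mod_shift_eq_iff[OF assms(3) that, of m] by (auto simp: inj_eq[OF assms(1)])
  hence "{a \<in> {..<n}. c i \<in> set_uprod (Upair (c a) (c ((a + m) mod n)))} = {i, ?j}"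
    using assms(3) j by blast
  moreover have "i \<noteq> ?j"
    using mod_shift_eq_iff[OF assms(3) assms(3), of m] mod_shift_neq[OF assms(2), of i] by auto
  ultimately show ?thesis by simp
qed

lemma count_image_mset_set:
  "finite A \<Longrightarrow> count (image_mset f (mset_set A)) e = card {a \<in> A. f a = e}"
  by (simp add: count_image_mset vimage_def Int_def conj_commute)

lemma size_filter_image_mset_set:
  "finite A \<Longrightarrow> size (filter_mset Q (image_mset f (mset_set A))) = card {a \<in> A. Q (f a)}"
  by (simp add: filter_mset_image_mset)

lemma count_edges_I_graph:
  assumes "\<not> n dvd k" "\<not> n dvd l" "i < n" "j < n"
  shows "count (edges (I_graph n k l)) (Upair (U i) (U j)) =
      of_bool (j = (i + l) mod n) + of_bool (j = (i + l * (n - 1)) mod n)"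
    and "count (edges (I_graph n k l)) (Upair (V i) (V j)) =
      of_bool (j = (i + k) mod n) + of_bool (j = (i + k * (n - 1)) mod n)"
    and "count (edges (I_graph n k l)) (Upair (U i) (V j)) = of_bool (j = i)"
    and "count (edges (I_graph n k l)) (Upair (V i) (U j)) = of_bool (j = i)"
proof -
  have inj: "inj U" "inj V" by (auto simp: inj_def)
  have spoke: "{a. a < n \<and> a = i \<and> a = j} = (if j = i then {i} else {})"
    "{a. a < n \<and> a = j \<and> a = i} = (if j = i then {i} else {})"
    using assms by auto
  show "count (edges (I_graph n k l)) (Upair (U i) (U j)) =
      of_bool (j = (i + l) mod n) + of_bool (j = (i + l * (n - 1)) mod n)"
    using card_rim_edges[OF inj(1) assms(2-4)]
    by (simp add: I_graph_def count_image_mset_set)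
  show "count (edges (I_graph n k l)) (Upair (V i) (V j)) =
      of_bool (j = (i + k) mod n) + of_bool (j = (i + k * (n - 1)) mod n)"
    using card_rim_edges[OF inj(2) assms(1,3,4)]
    by (simp add: I_graph_def count_image_mset_set)
  show "count (edges (I_graph n k l)) (Upair (U i) (V j)) = of_bool (j = i)"
    by (simp add: I_graph_def count_image_mset_set spoke)
  show "count (edges (I_graph n k l)) (Upair (V i) (U j)) = of_bool (j = i)"
    by (simp add: I_graph_def count_image_mset_set spoke)
qed

lemma degree_I_graph:
  assumes "\<not> n dvd k" "\<not> n dvd l" "v \<in> verts (I_graph n k l)"
  shows "multigraph_degree (I_graph n k l) v = 3"
proof -
  have inj: "inj U" "inj V" by (auto simp: inj_def)
  have one: "card {a. a < n \<and> i = a} = 1" if "i < n" for i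
  proof -
    have "{a. a < n \<and> i = a} = {i}" using that by auto
    thus ?thesis by simp
  qed
  consider i where "i < n" "v = U i" | i where "i < n" "v = V i"
    using assms(3) by (auto simp: I_graph_def)
  thus ?thesis
  proof cases
    case 1
    thus ?thesis
      using card_rim_edges_at[OF inj(1) assms(2)] one
      by (simp add: multigraph_degree_def I_graph_def size_filter_image_mset_set)
  next
    case 2
    thus ?thesis
      using card_rim_edges_at[OF inj(2) assms(1)] one
      by (simp add: multigraph_degree_def I_graph_def size_filter_image_mset_set)
  qed
qed

lemma laplacian_carrier: "laplacian_matrix vs G \<in> carrier_mat (length vs) (length vs)"
  unfolding laplacian_matrix_def adjacency_matrix_def degree_matrix_def
  by (intro minus_carrier_mat mat_carrier)

lemma laplacian_mult_coord_vec:
  assumes nk: "\<not> n dvd k" and nl: "\<not> n dvd l" and vs: "vertex_enumeration vs (I_graph n k l)"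
  shows "laplacian_matrix vs (I_graph n k l) *\<^sub>v coord_vec vs y = coord_vec vs (I_operator n k l y)"
proof (rule eq_vecI)
  fix a assume "a < dim_vec (coord_vec vs (I_operator n k l y))"
  hence a: "a < length vs" by (simp add: coord_vec_def)
  let ?G = "I_graph n k l" and ?v = "vs ! a"
  let ?N = "\<lambda>w. int (count (edges ?G) (Upair ?v w))"
  have v: "?v \<in> verts ?G" using a vs by (auto simp: vertex_enumeration_def)
  have "(laplacian_matrix vs ?G *\<^sub>v coord_vec vs y) $ a =
      (\<Sum>b<length vs. (if a = b then int (multigraph_degree ?G ?v) else 0) * y (vs ! b)
        - ?N (vs ! b) * y (vs ! b))"
    using a by (simp add: laplacian_matrix_def adjacency_matrix_def degree_matrix_def coord_vec_def
        scalar_prod_def atLeast0LessThan left_diff_distrib)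
  also have "\<dots> = (\<Sum>b<length vs. if a = b then 3 * y ?v else 0)
      - (\<Sum>b<length vs. ?N (vs ! b) * y (vs ! b))"
    unfolding sum_subtractf degree_I_graph[OF nk nl v]
    by (intro arg_cong2[where f = "(-)"] sum.cong) auto
  also have "\<dots> = 3 * y ?v - (\<Sum>b<length vs. ?N (vs ! b) * y (vs ! b))"
    using a by simp
  also have "\<dots> = 3 * y ?v - (\<Sum>i<n. ?N (U i) * y (U i)) - (\<Sum>i<n. ?N (V i) * y (V i))"
    by (simp add: sum_I_vertices[OF vs, of "\<lambda>w. ?N w * y w"])
  also have "\<dots> = I_operator n k l y ?v"
  proof -
    have delta: "(\<Sum>j<n. of_bool (j = m) * z j) = z m" if "m < n" for m and z :: "nat \<Rightarrow> int"
      using that by (simp add: of_bool_def if_distrib if_distribR cong: if_cong)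
    consider i where "i < n" "?v = U i" | i where "i < n" "?v = V i"
      using v by (auto simp: I_graph_def)
    thus ?thesis
      by cases (simp_all add: count_edges_I_graph[OF nk nl] distrib_right sum.distrib delta)
  qed
  finally show "(laplacian_matrix vs ?G *\<^sub>v coord_vec vs y) $ a =
      coord_vec vs (I_operator n k l y) $ a"
    using a by (simp add: coord_vec_def)
qed (simp add: coord_vec_def laplacian_matrix_def adjacency_matrix_def degree_matrix_def)

text \<open>
  Row \<open>u\<^sub>i\<close> of the Laplacian says \<open>v\<^sub>i = 3 u\<^sub>i - u\<^sub>i\<^sub>+\<^sub>l - u\<^sub>i\<^sub>-\<^sub>l\<close> in the cokernel. This forces the
  image of \<open>v\<^sub>i\<close> once \<open>u\<^sub>i\<close> is sent to \<open>X\<^sup>i\<close>.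
\<close>

fun vertex_poly :: "nat \<Rightarrow> nat \<Rightarrow> I_vertex \<Rightarrow> int poly" where
  "vertex_poly n l (U i) = monom 1 i"
| "vertex_poly n l (V i) = cycle_poly n l * monom 1 i"

definition vertex_combination :: "nat \<Rightarrow> nat \<Rightarrow> I_vertex list \<Rightarrow> int vec \<Rightarrow> int poly" where
  "vertex_combination n l vs x = (\<Sum>j<length vs. smult (x $ j) (vertex_poly n l (vs ! j)))"

lemma vertex_combination_coord_vec:
  assumes "vertex_enumeration vs (I_graph n k l)"
  shows "vertex_combination n l vs (coord_vec vs y) =
    cyclic_poly n (\<lambda>i. y (U i)) + cycle_poly n l * cyclic_poly n (\<lambda>i. y (V i))"
proof -
  have "vertex_combination n l vs (coord_vec vs y) =
      (\<Sum>j<length vs. smult (y (vs ! j)) (vertex_poly n l (vs ! j)))"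
    by (simp add: vertex_combination_def coord_vec_def)
  thus ?thesis
    using sum_I_vertices[OF assms, of "\<lambda>v. smult (y v) (vertex_poly n l v)"]
    by (simp add: cyclic_poly_def sum_distrib_left smult_monom flip: mult_smult_right)
qed

fun rim_residue_sum :: "nat \<Rightarrow> int poly \<Rightarrow> I_vertex \<Rightarrow> int" where
  "rim_residue_sum n f (U i) = residue_sum n f i"
| "rim_residue_sum n f (V i) = 0"

lemma residue_sum_cycle_poly:
  assumes "n > 0"
  shows "residue_sum n (cycle_poly n m * f) i = 3 * residue_sum n f i
    - residue_sum n f ((i + m) mod n) - residue_sum n f ((i + m * (n - 1)) mod n)"
  unfolding residue_sum_shift[OF dvd_shift(1)[OF assms, of m]]
    residue_sum_shift[OF dvd_shift(2)[OF assms, of m]]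
  by (simp add: cycle_poly_def left_diff_distrib residue_sum_diff residue_sum_smult)

lemma cyclic_poly_cycle:
  assumes "n > 0"
  shows "quot_cong n p
    (cyclic_poly n (\<lambda>i. 3 * z i - z ((i + m) mod n) - z ((i + m * (n - 1)) mod n)))
    (cycle_poly n m * cyclic_poly n z)"
proof -
  have "cyclic_poly n (\<lambda>i. 3 * z i - z ((i + m) mod n) - z ((i + m * (n - 1)) mod n)) =
      smult 3 (cyclic_poly n z) - cyclic_poly n (\<lambda>i. z ((i + m) mod n))
        - cyclic_poly n (\<lambda>i. z ((i + m * (n - 1)) mod n))"
    by (simp only: cyclic_poly_diff cyclic_poly_mult)
  also have "quot_cong n p \<dots> (smult 3 (cyclic_poly n z) - monom 1 (m * (n - 1)) * cyclic_poly n z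
        - monom 1 m * cyclic_poly n z)"
    by (intro quot_cong_diff quot_cong_refl cyclic_poly_shift dvd_shift assms)
  finally show ?thesis by (simp add: cycle_poly_def algebra_simps)
qed

text \<open>
  Identifying a function on the vertices with the pair \<open>(F, G)\<close> of its restrictions to the
  \<open>u\<^sub>i\<close> and the \<open>v\<^sub>i\<close>, read in \<open>\<int>[X]/(X\<^sup>n - 1)\<close>, the Laplacian becomes
  \<open>(F, G) \<mapsto> (Q\<^sub>l F - G, Q\<^sub>k G - F)\<close> with \<open>Q\<^sub>m = 3 - X\<^sup>m - X\<^sup>-\<^sup>m\<close>, and the map to \<open>\<int>[X]\<close> becomes
  \<open>(F, G) \<mapsto> F + Q\<^sub>l G\<close>. The composite is multiplication of \<open>G\<close> by \<open>Q\<^sub>l Q\<^sub>k - 1\<close>. In the other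
  direction \<open>f\<close> goes to \<open>(f, 0)\<close>.
\<close>

lemma coker_laplacian_I_graph:
  assumes pos: "n > 0" "k > 0" "l > 0" and nk: "\<not> n dvd k" and nl: "\<not> n dvd l"
    and vs: "vertex_enumeration vs (I_graph n k l)"
  shows "coker (laplacian_matrix vs (I_graph n k l)) \<cong>
    quotient_group (relation_ideal n (shifted_poly (I_laurent k l)))"
proof (rule coker_iso_quotient_group[where b = "vertex_combination n l vs"
        and d = "\<lambda>f. coord_vec vs (rim_residue_sum n f)"])
  let ?L = "laplacian_matrix vs (I_graph n k l)" and ?p = "shifted_poly (I_laurent k l)"
  let ?Ql = "cycle_poly n l" and ?Qk = "cycle_poly n k"
  have distinct: "distinct vs" and set: "set vs = U ` {..<n} \<union> V ` {..<n}"
    using vs by (auto simp: vertex_enumeration_def I_graph_def)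
  note mult = laplacian_mult_coord_vec[OF nk nl vs]
  note comb = vertex_combination_coord_vec[OF vs]
  show "?L \<in> carrier_mat (length vs) (length vs)" by (rule laplacian_carrier)
  show "vertex_combination n l vs (x + y) = vertex_combination n l vs x + vertex_combination n l vs y"
    if "x \<in> carrier_vec (length vs)" "y \<in> carrier_vec (length vs)" for x y
    using that by (simp add: vertex_combination_def smult_add_left sum.distrib)
  show "vertex_combination n l vs (?L *\<^sub>v x) \<in> relation_ideal n ?p"
    if x: "x \<in> carrier_vec (length vs)" for x
  proof -
    obtain y where y: "x = coord_vec vs y" using coord_vec_exhaust[OF distinct x] .
    let ?F = "cyclic_poly n (\<lambda>i. y (U i))" and ?G = "cyclic_poly n (\<lambda>i. y (V i))"
    have "vertex_combination n l vs (?L *\<^sub>v x) =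
        (cyclic_poly n (\<lambda>i. 3 * y (U i) - y (U ((i + l) mod n)) - y (U ((i + l * (n - 1)) mod n))) - ?G)
        + ?Ql * (cyclic_poly n (\<lambda>i. 3 * y (V i) - y (V ((i + k) mod n))
            - y (V ((i + k * (n - 1)) mod n))) - ?F)"
      unfolding y mult comb by (simp add: cyclic_poly_diff)
    also have "quot_cong n ?p \<dots> ((?Ql * ?F - ?G) + ?Ql * (?Qk * ?G - ?F))"
      by (intro quot_cong_add quot_cong_mult quot_cong_diff quot_cong_refl
          cyclic_poly_cycle[OF pos(1), where z = "\<lambda>i. y (U i)"]
          cyclic_poly_cycle[OF pos(1), where z = "\<lambda>i. y (V i)"])
    also have "\<dots> = (?Ql * ?Qk - 1) * ?G" by (simp add: algebra_simps)
    also have "quot_cong n ?p \<dots> (0 * ?G)"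
      by (intro quot_cong_mult quot_cong_refl cycle_poly_product_cong_1 pos)
    finally show ?thesis by (simp add: quot_cong_def)
  qed
  show "\<exists>x\<in>carrier_vec (length vs). coord_vec vs (rim_residue_sum n f) = ?L *\<^sub>v x"
    if f: "f \<in> relation_ideal n ?p" for f
  proof -
    obtain f1 g where "f = f1 * (monom 1 n - 1) + g * ?p"
      using f unfolding relation_ideal_def by blast
    hence "f - g * ?p = f1 * (monom 1 n - 1) + 0 * 0" by simp
    hence "quot_cong n 0 f (g * ?p)" unfolding quot_cong_def relation_ideal_def by blast
    also have "quot_cong n 0 \<dots> (g * (monom 1 (k + l) * (?Ql * ?Qk - 1)))"
      by (intro quot_cong_mult quot_cong_refl quot_cong_sym[OF cycle_poly_product] pos)
    finally have f_cong: "quot_cong n 0 f (g * (monom 1 (k + l) * (?Ql * ?Qk - 1)))" .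
    \<comment> \<open>The Laplacian sends \<open>(Q\<^sub>k h, h)\<close> to \<open>((Q\<^sub>l Q\<^sub>k - 1) h, 0)\<close>.\<close>
    define h where "h = monom 1 (k + l) * g"
    define y where "y = (\<lambda>v. case v of U i \<Rightarrow> residue_sum n (?Qk * h) i | V i \<Rightarrow> residue_sum n h i)"
    have "rim_residue_sum n f v = I_operator n k l y v" for v
    proof (cases v)
      case (U i)
      have "residue_sum n f i = residue_sum n (?Ql * (?Qk * h) - h) i"
        using residue_sum_cong[OF f_cong, of i] by (simp add: h_def algebra_simps)
      thus ?thesis using U
        by (simp add: y_def residue_sum_diff residue_sum_cycle_poly[OF pos(1), of l])
    next
      case (V i)
      thus ?thesis by (simp add: y_def residue_sum_cycle_poly[OF pos(1)])
    qed
    hence "coord_vec vs (rim_residue_sum n f) = ?L *\<^sub>v coord_vec vs y"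
      unfolding mult by (simp add: coord_vec_def)
    thus ?thesis using coord_vec_carrier by blast
  qed
  show "vertex_combination n l vs (coord_vec vs (rim_residue_sum n f)) - f \<in> relation_ideal n ?p" for f
    using cyclic_poly_residue_sum[OF pos(1)] unfolding comb
    by (simp add: cyclic_poly_0 quot_cong_def)
  show "\<exists>z\<in>carrier_vec (length vs). x =
      coord_vec vs (rim_residue_sum n (vertex_combination n l vs x)) + ?L *\<^sub>v z"
    if x: "x \<in> carrier_vec (length vs)" for x
  proof -
    obtain y where y: "x = coord_vec vs y" using coord_vec_exhaust[OF distinct x] .
    \<comment> \<open>The pair \<open>(F, G)\<close> differs from \<open>(F + Q\<^sub>l G, 0)\<close> by
      the image \<open>(- Q\<^sub>l G, G)\<close> of \<open>(- G, 0)\<close>.\<close>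
    define z where "z = (\<lambda>v. case v of U i \<Rightarrow> - y (V i) | V i \<Rightarrow> 0)"
    have "y v = rim_residue_sum n (vertex_combination n l vs x) v + I_operator n k l z v"
      if v: "v \<in> set vs" for v
    proof -
      consider i where "i < n" "v = U i" | i where "i < n" "v = V i"
        using v set by auto
      thus ?thesis
        by cases (simp_all add: y comb z_def residue_sum_add residue_sum_cycle_poly[OF pos(1)]
            residue_sum_cyclic_poly)
    qed
    hence "x = coord_vec vs (rim_residue_sum n (vertex_combination n l vs x)) + ?L *\<^sub>v coord_vec vs z"
      unfolding mult coord_vec_add by (subst (1) y) (rule coord_vec_cong)
    thus ?thesis using coord_vec_carrier by blast
  qed
qed (simp_all add: relation_ideal_0 relation_ideal_add relation_ideal_uminus)

theorem theorem4p1: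
  fixes n k l :: nat and vs :: "I_vertex list"
  assumes "n > 0" and "k > 0" and "l > 0"
    and "gcd k l = 1"
    and "\<not> n dvd k" and "\<not> n dvd l"
    and "vertex_enumeration vs (I_graph n k l)"
  shows "coker (laplacian_matrix vs (I_graph n k l))
       \<cong> coker (companion_matrix (I_laurent k l) ^\<^sub>m n - 1\<^sub>m (2 * (k + l)))"
proof -
  let ?P = "I_laurent k l" and ?p = "shifted_poly (I_laurent k l)"
  have bimonic: "bimonic ?P" and width: "span_width ?P = 2 * (k + l)"
    using assms by (simp_all add: I_laurent_exponents)
  have degree: "degree ?p = 2 * (k + l)" and monic: "lead_coeff ?p = 1"
    using shifted_poly_bimonic[OF bimonic] width by simp_all
  have "coker (laplacian_matrix vs (I_graph n k l)) \<cong> quotient_group (relation_ideal n ?p)"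
    by (rule coker_laplacian_I_graph) (use assms in auto)
  also have "quotient_group (relation_ideal n ?p) \<cong> coker (companion ?p ^\<^sub>m n - 1\<^sub>m (degree ?p))"
  proof (rule group.iso_sym)
    show "group (coker (companion ?p ^\<^sub>m n - 1\<^sub>m (degree ?p)))"
      using comm_group_coker comm_group.axioms(2) by blast
    show "coker (companion ?p ^\<^sub>m n - 1\<^sub>m (degree ?p)) \<cong> quotient_group (relation_ideal n ?p)"
      by (rule coker_companion_power[OF monic]) (use degree assms in simp)
  qed
  finally show ?thesis
    unfolding companion_matrix_eq_companion[OF bimonic] degree .
qed

end
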